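(* Let $n$ be a positive integer and let $p,k$ be nonnegative integers. There is a bijection between the set of descending plane partitions of order $n$ with no special parts, exactly $p$ parts in total, and exactly $k$ parts equal to $n$, and the set of $n\times n$ permutation matrices with inversion number $p$ whose unique $1$ in the last column lies in row $n-k$.
   Context: A descending plane partition (DPP) is an array of positive integers $\{a_{i,j}\}$ with $i\le j$, placed in shifted shape (row $i$ is indented by $i-1$ units, so row $i$ occupies consecutive positions $(i,i),(i,i+1),\dots$), such that entries weakly decrease along each row, strictly decrease down each column, and for each row the number of parts in that row is strictly less than the largest part in that row and is greater than or equal to the largest part in the next row. The empty array is a DPP. A DPP is of order $n$ if its largest part is at most $n$. A special part of a DPP is an entry $a_{i,j}$ with $a_{i,j}\le j-i$. For an $n\times n$ matrix $A=(A_{ij})$, the inversion number is $I(A)=\sum A_{ij}A_{k\ell}$ over all $i,j,k,\ell$ with $i>k$ and $j<\ell$; for a permutation matrix this is the number of pairs of $1$'s one of which lies strictly below and strictly to the left of the other. Rows are numbered $1,\dots,n$ from top to bottom. *)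

theory Defs
  imports "Jordan_Normal_Form.Matrix"
begin

(* A shifted array is given by the list of its nonempty rows, top to bottom. All indices are
   0-based, so the i-th row occupies the positions (i,i), (i,i+1), ..., and the entry a_{i,j} is
   D ! i ! (j - i). Everything below depends only on the relative position of cells, so the shift
   by one with respect to 1-based numbering is immaterial. *)

definition cells :: "nat list list \<Rightarrow> (nat \<times> nat) set" where
  "cells D = {(i, j). i < length D \<and> i \<le> j \<and> j < i + length (D ! i)}"

definition part :: "nat list list \<Rightarrow> nat \<Rightarrow> nat \<Rightarrow> nat" where
  "part D i j = D ! i ! (j - i)"

(* The last two conditions force the row lengths to be strictly decreasing, so that the array
   has the shape of a shifted Young diagram. *)

definition is_dpp :: "nat list list \<Rightarrow> bool" where
  "is_dpp D \<longleftrightarrow>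
     (\<forall>row \<in> set D. row \<noteq> []) \<and>
     (\<forall>(i, j) \<in> cells D. 0 < part D i j) \<and>
     (\<forall>i j. (i, j) \<in> cells D \<and> (i, Suc j) \<in> cells D \<longrightarrow> part D i (Suc j) \<le> part D i j) \<and>
     (\<forall>i j. (i, j) \<in> cells D \<and> (Suc i, j) \<in> cells D \<longrightarrow> part D (Suc i) j < part D i j) \<and>
     (\<forall>i < length D. length (D ! i) < Max (set (D ! i))) \<and>
     (\<forall>i. Suc i < length D \<longrightarrow> Max (set (D ! Suc i)) \<le> length (D ! i))"

definition dpp_of_order :: "nat \<Rightarrow> nat list list \<Rightarrow> bool" where
  "dpp_of_order n D \<longleftrightarrow> is_dpp D \<and> (\<forall>(i, j) \<in> cells D. part D i j \<le> n)"

definition special_parts :: "nat list list \<Rightarrow> (nat \<times> nat) set" where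
  "special_parts D = {(i, j) \<in> cells D. part D i j \<le> j - i}"

definition num_parts :: "nat list list \<Rightarrow> nat" where
  "num_parts D = card (cells D)"

definition num_parts_eq :: "nat \<Rightarrow> nat list list \<Rightarrow> nat" where
  "num_parts_eq m D = card {(i, j) \<in> cells D. part D i j = m}"

definition permutation_matrix :: "nat \<Rightarrow> int mat \<Rightarrow> bool" where
  "permutation_matrix n A \<longleftrightarrow>
     A \<in> carrier_mat n n \<and>
     (\<forall>i<n. \<forall>j<n. A $$ (i, j) \<in> {0, 1}) \<and>
     (\<forall>i<n. \<exists>!j. j < n \<and> A $$ (i, j) = 1) \<and>
     (\<forall>j<n. \<exists>!i. i < n \<and> A $$ (i, j) = 1)"

definition inversion_number :: "int mat \<Rightarrow> int" where
  "inversion_number A =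
     (\<Sum>i<dim_row A. \<Sum>j<dim_col A. \<Sum>k<i. \<Sum>l\<in>{j<..<dim_col A}. A $$ (i, j) * A $$ (k, l))"

end

theory Submission
  imports Defs "HOL-Combinatorics.Permutations" "HOL-Library.Multiset"
begin

text \<open>
  In a descending plane partition without special parts, a row of length \<open>l\<close> has all parts
  \<open>\<ge> l\<close>, and all parts of the following rows are \<open>\<le> l\<close>. Reading the rows one after the
  other therefore gives a weakly decreasing word, and strictness along the columns says exactly that
  the value \<open>l\<close> occurs at most \<open>l - 1\<close> times. Conversely, a weakly decreasing word
  \<open>w\<close> in which every \<open>v\<close> occurs at most \<open>v - 1\<close> times can be cut into rows in a unique
  way: the first row consists of the positions \<open>t\<close> (counted from \<open>0\<close>) with \<open>w ! t > t\<close>.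
  So these arrays correspond to multiplicity vectors \<open>0 \<le> m v \<le> v - 1\<close>, which are the Lehmer
  codes of permutations: \<open>m v\<close> counts the inversions whose right end is in column \<open>v\<close>.
\<close>

section \<open>Arrays without special parts as words\<close>

text \<open>In a weakly decreasing row the smallest part is the last one, and it stands at the
  largest offset \<open>length r - 1\<close>. Hence \<open>length r \<le> last r\<close> alone
  excludes special parts. The final conjunct is the length condition of a DPP with
  \<open>hd r\<close> as the largest part.\<close>

definition nonspecial_row :: "nat list \<Rightarrow> bool" where
  "nonspecial_row r \<longleftrightarrow> r \<noteq> [] \<and> sorted_wrt (\<ge>) r \<and> length r \<le> last r \<and> length r < hd r"

definition fits_below :: "nat list \<Rightarrow> nat list \<Rightarrow> bool" where
  "fits_below r s \<longleftrightarrow> hd s \<le> length r \<and>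
     (\<forall>t. t < length s \<and> Suc t < length r \<longrightarrow> s ! t < r ! Suc t)"

definition nonspecial_dpp :: "nat list list \<Rightarrow> bool" where
  "nonspecial_dpp D \<longleftrightarrow> (\<forall>r\<in>set D. nonspecial_row r) \<and> successively fits_below D"

lemma nonspecial_dpp_Nil: "nonspecial_dpp []"
  by (simp add: nonspecial_dpp_def)

lemma nonspecial_dpp_Cons:
  "nonspecial_dpp (r # D) \<longleftrightarrow>
     nonspecial_row r \<and> nonspecial_dpp D \<and> (D \<noteq> [] \<longrightarrow> fits_below r (hd D))"
  by (auto simp: nonspecial_dpp_def successively_Cons)

section \<open>From conditions on cells to conditions on rows\<close>

lemma Ball_cells:
  "(\<forall>(i, j)\<in>cells D. P i j) \<longleftrightarrow> (\<forall>i<length D. \<forall>t<length (D ! i). P i (i + t))"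
  unfolding cells_def by (auto, metis le_add_diff_inverse nat_add_left_cancel_less)

lemma part_add [simp]: "part D i (i + t) = D ! i ! t" "part D i (Suc (i + t)) = D ! i ! Suc t"
  by (simp_all add: part_def)

lemma part_Suc_add [simp]: "part D (Suc i) (Suc (i + t)) = D ! Suc i ! t"
  by (simp add: part_def)

lemma rows_weakly_decreasing:
  "(\<forall>i j. (i, j) \<in> cells D \<and> (i, Suc j) \<in> cells D \<longrightarrow> part D i (Suc j) \<le> part D i j)
   \<longleftrightarrow> (\<forall>r\<in>set D. sorted_wrt (\<ge>) r)"  (is "?L \<longleftrightarrow> ?R")
proof -
  have "?L \<longleftrightarrow> (\<forall>(i, j)\<in>cells D. (i, Suc j) \<in> cells D \<longrightarrow> part D i (Suc j) \<le> part D i j)"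
    by auto
  also have "\<dots> \<longleftrightarrow> (\<forall>i<length D. \<forall>t. Suc t < length (D ! i) \<longrightarrow> D ! i ! Suc t \<le> D ! i ! t)"
    unfolding Ball_cells by (auto simp: cells_def)
  also have "\<dots> \<longleftrightarrow> ?R"
    by (simp add: all_set_conv_all_nth sorted_wrt_iff_nth_Suc_transp transp_def)
  finally show ?thesis .
qed

lemma columns_strictly_decreasing:
  "(\<forall>i j. (i, j) \<in> cells D \<and> (Suc i, j) \<in> cells D \<longrightarrow> part D (Suc i) j < part D i j)
   \<longleftrightarrow> (\<forall>i. Suc i < length D \<longrightarrow> (\<forall>t. t < length (D ! Suc i) \<and> Suc t < length (D ! i)
           \<longrightarrow> D ! Suc i ! t < D ! i ! Suc t))" (is "?L \<longleftrightarrow> ?R")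
proof
  assume L: ?L
  show ?R
  proof (intro allI impI)
    fix i t assume "Suc i < length D" "t < length (D ! Suc i) \<and> Suc t < length (D ! i)"
    then show "D ! Suc i ! t < D ! i ! Suc t"
      using L[rule_format, of i "Suc (i + t)"] by (auto simp: cells_def)
  qed
next
  assume R: ?R
  show ?L
  proof (intro allI impI)
    fix i j assume *: "(i, j) \<in> cells D \<and> (Suc i, j) \<in> cells D"
    then obtain t where "j = Suc (i + t)"
      by (auto simp: cells_def dest: less_imp_Suc_add[of i j] Suc_le_lessD)
    with * R show "part D (Suc i) j < part D i j"
      by (auto simp: cells_def)
  qed
qed

lemma Max_set_antimono_list:
  fixes r :: "'a::linorder list"
  assumes "sorted_wrt (\<ge>) r" "r \<noteq> []"
  shows "Max (set r) = hd r"
  using assms by (cases r) (auto intro!: Max_eqI)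

lemma last_le_antimono_list:
  fixes r :: "'a::linorder list"
  assumes "sorted_wrt (\<ge>) r" "x \<in> set r"
  shows "last r \<le> x"
  using assms by (induction r) auto

text \<open>For nonempty sorted rows \<open>Max\<close> is the head, and "no special parts" says
  that every part exceeds its offset. This also yields positivity of the parts, so that condition
  has no counterpart in \<open>nonspecial_dpp\<close>.\<close>

lemma is_dpp_no_special_iff:
  "is_dpp D \<and> special_parts D = {} \<longleftrightarrow> nonspecial_dpp D"
proof -
  let ?nonempty = "\<forall>r\<in>set D. r \<noteq> []" and ?sorted = "\<forall>r\<in>set D. sorted_wrt (\<ge>) r"
  have special: "special_parts D = {} \<longleftrightarrow> (\<forall>r\<in>set D. \<forall>t<length r. t < r ! t)"
  proof -
    have "special_parts D = {} \<longleftrightarrow> (\<forall>(i, j)\<in>cells D. j - i < part D i j)"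
      by (auto simp: special_parts_def not_le)
    then show ?thesis
      unfolding Ball_cells by (simp add: all_set_conv_all_nth)
  qed
  have long: "(\<forall>t<length r. t < r ! t) \<longleftrightarrow> length r \<le> last r"
    if "r \<noteq> []" "sorted_wrt (\<ge>) r" for r :: "nat list"
  proof
    assume "\<forall>t<length r. t < r ! t"
    with that have "length r - 1 < r ! (length r - 1)" by simp
    with that show "length r \<le> last r" by (simp add: last_conv_nth)
  next
    assume "length r \<le> last r"
    then show "\<forall>t<length r. t < r ! t"
      using last_le_antimono_list[OF that(2)] by (meson le_trans less_le_trans nth_mem)
  qed
  have positive: "(\<forall>(i, j)\<in>cells D. 0 < part D i j)" if "\<forall>r\<in>set D. \<forall>t<length r. t < r ! t"
    unfolding Ball_cells using that by fastforce
  have max: "\<forall>i<length D. Max (set (D ! i)) = hd (D ! i)" if ?nonempty ?sorted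
    using that by (simp add: Max_set_antimono_list)
  have row: "(\<forall>r\<in>set D. nonspecial_row r) \<longleftrightarrow> ?nonempty \<and> ?sorted \<and>
      (\<forall>r\<in>set D. \<forall>t<length r. t < r ! t) \<and> (\<forall>i<length D. length (D ! i) < Max (set (D ! i)))"
    (is "?A \<longleftrightarrow> ?B")
  proof (cases "?nonempty \<and> ?sorted")
    case True
    then have "(\<forall>i<length D. length (D ! i) < Max (set (D ! i))) \<longleftrightarrow> (\<forall>r\<in>set D. length r < hd r)"
      using max by (simp add: all_set_conv_all_nth)
    then show ?thesis
      using True long by (auto simp: nonspecial_row_def)
  qed (auto simp: nonspecial_row_def)
  have below: "successively fits_below D \<longleftrightarrow>
      (\<forall>i j. (i, j) \<in> cells D \<and> (Suc i, j) \<in> cells D \<longrightarrow> part D (Suc i) j < part D i j) \<and>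
      (\<forall>i. Suc i < length D \<longrightarrow> Max (set (D ! Suc i)) \<le> length (D ! i))" if ?nonempty ?sorted
    unfolding columns_strictly_decreasing successively_conv_nth fits_below_def
    using max[OF that] by auto
  show ?thesis
    unfolding is_dpp_def special rows_weakly_decreasing nonspecial_dpp_def
    using row below positive by blast
qed

section \<open>Statistics of the array read off the concatenated word\<close>

lemma card_cells_eq_length_filter:
  "card {(i, j) \<in> cells D. P (part D i j)} = length (filter P (concat D))"
proof -
  let ?S = "SIGMA i:{..<length D}. {t. t < length (D ! i) \<and> P (D ! i ! t)}"
  have "{(i, j) \<in> cells D. P (part D i j)} = (\<lambda>(i, t). (i, i + t)) ` ?S"
  proof
    show "{(i, j) \<in> cells D. P (part D i j)} \<subseteq> (\<lambda>(i, t). (i, i + t)) ` ?S"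
    proof clarify
      fix i j assume *: "(i, j) \<in> cells D" "P (part D i j)"
      then have "(i, j - i) \<in> ?S" by (auto simp: cells_def part_def)
      moreover have "i \<le> j" using * by (simp add: cells_def)
      ultimately show "(i, j) \<in> (\<lambda>(i, t). (i, i + t)) ` ?S"
        by (force intro!: rev_image_eqI)
    qed
  qed (auto simp: cells_def)
  moreover have "inj_on (\<lambda>(i, t). (i, i + t)) ?S"
    by (auto simp: inj_on_def)
  ultimately have "card {(i, j) \<in> cells D. P (part D i j)} = card ?S"
    by (simp add: card_image)
  also have "\<dots> = (\<Sum>i<length D. length (filter P (D ! i)))"
    by (simp add: length_filter_conv_card)
  also have "\<dots> = length (filter P (concat D))"
    by (simp add: filter_concat length_concat sum_list_sum_nth o_def atLeast0LessThan)
  finally show ?thesis .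
qed

lemma num_parts_eq_length: "num_parts D = length (concat D)"
  using card_cells_eq_length_filter[of D "\<lambda>_. True"]
  by (simp add: num_parts_def)

lemma num_parts_eq_count_list: "num_parts_eq m D = count_list (concat D) m"
  using card_cells_eq_length_filter[of D "(=) m"]
  by (simp add: num_parts_eq_def count_list_eq_length_filter eq_commute[of m])

lemma dpp_of_order_iff:
  "dpp_of_order n D \<and> special_parts D = {} \<longleftrightarrow> nonspecial_dpp D \<and> (\<forall>v\<in>set (concat D). v \<le> n)"
proof -
  have "(\<forall>(i, j)\<in>cells D. part D i j \<le> n) \<longleftrightarrow> (\<forall>v\<in>set (concat D). v \<le> n)"
    unfolding Ball_cells by (simp add: all_set_conv_all_nth)
  then show ?thesis
    unfolding dpp_of_order_def is_dpp_no_special_iff[symmetric] by blast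
qed

section \<open>Weakly decreasing words with bounded multiplicities\<close>

definition code_word :: "nat list \<Rightarrow> bool" where
  "code_word w \<longleftrightarrow> sorted_wrt (\<ge>) w \<and> (\<forall>v. count_list w v \<le> v - 1)"

lemma code_word_drop:
  assumes "code_word w"
  shows "code_word (drop k w)"
proof -
  have "count_list (drop k w) v \<le> count_list w v" for v
    by (metis append_take_drop_id count_list_append le_add2)
  with assms show ?thesis
    unfolding code_word_def by (meson le_trans sorted_wrt_drop)
qed

text \<open>The head of each row is at most the length of the row above it, which is less than the
  head of that row. So the heads decrease down the array.\<close>

lemma nonspecial_dpp_le_hd:
  assumes "nonspecial_dpp D" "x \<in> set (concat D)"
  shows "x \<le> hd (hd D)"
  using assms
proof (induction D)
  case (Cons r D)
  then have row: "nonspecial_row r" and D: "nonspecial_dpp D"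
    by (auto simp: nonspecial_dpp_Cons)
  show ?case
  proof (cases "x \<in> set r")
    case True
    with row show ?thesis by (cases r) (auto simp: nonspecial_row_def)
  next
    case False
    with Cons have "x \<le> hd (hd D)" "D \<noteq> []" by (auto simp: nonspecial_dpp_Cons)
    then show ?thesis
      using Cons.prems(1) by (auto simp: nonspecial_dpp_Cons nonspecial_row_def fits_below_def)
  qed
qed simp

lemma nonspecial_dpp_tail_le:
  assumes "nonspecial_dpp (r # D)" "x \<in> set (concat D)"
  shows "x \<le> length r"
proof -
  have "D \<noteq> []" using assms by auto
  then show ?thesis
    using assms nonspecial_dpp_le_hd[of D x] by (auto simp: nonspecial_dpp_Cons fits_below_def)
qed

lemma count_list_conv_card: "count_list xs v = card {i. i < length xs \<and> xs ! i = v}"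
  by (simp add: count_list_eq_length_filter length_filter_conv_card eq_commute)

text \<open>Let \<open>l\<close> be the length of the first row. Its parts are at least
  \<open>l\<close> and all later parts are at most \<open>l\<close>, so the word is sorted. A value
  below \<open>l\<close> occurs only in the tail, where induction applies. A value above
  \<open>l\<close> occurs only in the first row, at most \<open>l\<close> times. Only the value
  \<open>l\<close> itself can occur on both sides, and then only in the first two rows.\<close>

lemma nonspecial_dpp_imp_code_word:
  assumes "nonspecial_dpp D"
  shows "code_word (concat D)"
  using assms
proof (induction D)
  case Nil
  then show ?case by (simp add: code_word_def)
next
  case (Cons r D)
  then have row: "nonspecial_row r" and D: "nonspecial_dpp D" and IH: "code_word (concat D)"
    by (auto simp: nonspecial_dpp_Cons)
  let ?l = "length r"
  have r_ge: "?l \<le> x" if "x \<in> set r" for x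
    using row last_le_antimono_list[of r x] that by (auto simp: nonspecial_row_def)
  have tail_le: "x \<le> ?l" if "x \<in> set (concat D)" for x
    using nonspecial_dpp_tail_le[OF Cons.prems that] .
  have "sorted_wrt (\<ge>) (r @ concat D)"
    unfolding sorted_wrt_append
    using row IH r_ge tail_le by (auto simp: nonspecial_row_def code_word_def intro: le_trans)
  moreover have "count_list (r @ concat D) v \<le> v - 1" for v
  proof (cases v ?l rule: linorder_cases)
    case less
    then have "v \<notin> set r" using r_ge by fastforce
    then have "count_list r v = 0" by (simp add: count_list_0_iff)
    then show ?thesis using IH by (simp add: code_word_def)
  next
    case greater
    then have "v \<notin> set (concat D)" using tail_le[of v] by (meson not_less)
    then have "count_list (concat D) v = 0" by (rule count_notin)
    then show ?thesis using greater count_le_length[of r v] by simp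
  next
    case equal
    show ?thesis
    proof (cases D)
      case Nil
      obtain x xs where r: "r = x # xs" using row by (cases r) (auto simp: nonspecial_row_def)
      then have "x \<noteq> v" using row equal by (auto simp: nonspecial_row_def)
      then show ?thesis using Nil r equal count_le_length[of xs v] by simp
    next
      case (Cons s E)
      have s: "nonspecial_row s" "fits_below r s" "nonspecial_dpp (s # E)"
        using \<open>nonspecial_dpp (r # D)\<close> Cons by (auto simp: nonspecial_dpp_Cons)
      then have s_short: "length s < ?l" by (auto simp: nonspecial_row_def fits_below_def)
      have "v \<notin> set (concat E)"
        using nonspecial_dpp_tail_le[OF s(3), of v] s_short equal by auto
      then have "count_list (concat E) v = 0" by (rule count_notin)
      then have count: "count_list (r @ concat D) v = count_list r v + count_list s v"
        using Cons by simp
      let ?R = "{t. t < length r \<and> r ! t = v}" and ?S = "{t. t < length s \<and> s ! t = v}"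
      txt \<open>An entry \<open>l\<close> at offset \<open>t\<close> of the next row sits below offset \<open>t + 1\<close> of this row,
        which then is not \<open>l\<close>; so both kinds of occurrences fit into the \<open>l - 1\<close> offsets
        \<open>1, \<dots>, l - 1\<close>.\<close>
      have "?R \<union> Suc ` ?S \<subseteq> {1..<?l}"
      proof -
        have "r ! 0 \<noteq> v" using row equal by (auto simp: nonspecial_row_def hd_conv_nth)
        then have "t \<noteq> 0" if "t \<in> ?R" for t using that by (cases t) auto
        then show ?thesis using s_short by fastforce
      qed
      moreover have "?R \<inter> Suc ` ?S = {}"
        using s(2) by (auto simp: fits_below_def)
      ultimately have "card ?R + card (Suc ` ?S) \<le> card {1..<?l}"
        by (metis (no_types, lifting) card_Un_disjoint card_mono finite_Un finite_atLeastLessThan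
            finite_subset)
      then show ?thesis
        unfolding count unfolding count_list_conv_card using equal by (simp add: card_image)
    qed
  qed
  ultimately show ?case by (simp add: code_word_def)
qed

text \<open>If \<open>s\<close> were longer, the letter at position \<open>length r\<close> would
  lie in the tail after \<open>r\<close>, hence be at most \<open>length r\<close>. It would also
  lie in \<open>s\<close>, hence be at least \<open>length s\<close>.\<close>

lemma nonspecial_first_row_length_le:
  assumes "nonspecial_dpp (r # D)" "nonspecial_dpp (s # E)" "r @ concat D = s @ concat E"
  shows "length s \<le> length r"
proof (rule ccontr)
  let ?l = "length r"
  assume "\<not> length s \<le> ?l"
  then have less: "?l < length s" by simp
  have len: "length (r @ concat D) = length (s @ concat E)" using assms(3) by (rule arg_cong)
  have "concat D \<noteq> []" using less len by (auto simp del: concat_eq_Nil_conv)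
  then have "(r @ concat D) ! ?l \<in> set (concat D)"
    unfolding nth_append_length_plus[of r _ 0, simplified] by (intro nth_mem) blast
  then have "(r @ concat D) ! ?l \<le> ?l" using nonspecial_dpp_tail_le[OF assms(1)] by blast
  moreover have "(s @ concat E) ! ?l = s ! ?l" using less by (simp add: nth_append)
  moreover have "length s \<le> s ! ?l"
    using assms(2) last_le_antimono_list[of s "s ! ?l"] less
    by (auto simp: nonspecial_dpp_Cons nonspecial_row_def)
  ultimately show False using assms(3) less by simp
qed

lemma nonspecial_dpp_concat_inj:
  assumes "nonspecial_dpp D" "nonspecial_dpp E" "concat D = concat E"
  shows "D = E"
  using assms
proof (induction D arbitrary: E)
  case Nil
  then show ?case by (cases E) (auto simp: nonspecial_dpp_Cons nonspecial_row_def)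
next
  case (Cons r D)
  then obtain s F where E: "E = s # F"
    by (cases E) (auto simp: nonspecial_dpp_Cons nonspecial_row_def)
  have eq: "r @ concat D = s @ concat F" using Cons.prems E by simp
  have "length r = length s"
    using nonspecial_first_row_length_le[of r D s F] nonspecial_first_row_length_le[of s F r D]
      Cons.prems E eq by simp
  then have "r = s" "concat D = concat F" using eq by auto
  then show ?case using Cons E by (auto simp: nonspecial_dpp_Cons)
qed

text \<open>A value repeated at positions \<open>a\<close> and \<open>b > a\<close> fills everything in between.\<close>

lemma code_word_spread:
  assumes "code_word w" "a \<le> b" "b < length w" "w ! a \<le> w ! b"
  shows "b - a < w ! a - 1"
proof -
  have antimono: "w ! j \<le> w ! i" if "i \<le> j" "j < length w" for i j
    using assms(1) that by (cases "i = j") (auto simp: code_word_def sorted_wrt_iff_nth_less)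
  have "{a..b} \<subseteq> {i. i < length w \<and> w ! i = w ! a}"
    using assms antimono by (auto, meson le_antisym le_trans le_less_trans)
  then have "card {a..b} \<le> count_list w (w ! a)"
    unfolding count_list_conv_card by (intro card_mono) auto
  also have "\<dots> \<le> w ! a - 1" using assms(1) by (simp add: code_word_def)
  finally show ?thesis using assms(2) by simp
qed

text \<open>A maximal prefix whose letters all exceed their positions becomes the first row; the
  remaining suffix is again a code word and is cut by induction on the length.\<close>

lemma code_word_imp_nonspecial_dpp:
  assumes "code_word w"
  shows "\<exists>D. nonspecial_dpp D \<and> concat D = w"
  using assms
proof (induction w rule: length_induct)
  case (1 w)
  show ?case
  proof (cases "w = []")
    case True
    then show ?thesis using nonspecial_dpp_Nil by (intro exI[of _ "[]"]) simp
  next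
    case False
    \<comment> \<open>The implication makes \<open>length w\<close> a valid candidate, so
      \<open>l\<close> is the whole length if every letter exceeds its position.\<close>
    define l where "l = (LEAST t. t < length w \<longrightarrow> w ! t \<le> t)"
    have antimono: "w ! j \<le> w ! i" if "i \<le> j" "j < length w" for i j
      using 1(2) that by (cases "i = j") (auto simp: code_word_def sorted_wrt_iff_nth_less)
    have l: "l < length w \<longrightarrow> w ! l \<le> l"
      unfolding l_def by (rule LeastI[of _ "length w"]) simp
    have below_l: "t < length w \<and> t < w ! t" if "t < l" for t
      using not_less_Least[OF that[unfolded l_def]] by auto
    have "l \<le> length w" using below_l[of "length w"] by (meson less_irrefl not_le)
    have "0 < w ! 0" using code_word_spread[OF 1(2), of 0 0] False by simp
    then have "0 < l" using l False by (cases l) auto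
    then have w_pred: "l \<le> w ! (l - 1)" "l - 1 < length w"
      using below_l[of "l - 1"] by auto
    \<comment> \<open>Otherwise \<open>w ! 0 \<le> l \<le> w ! (l - 1)\<close>, so the first
      \<open>l\<close> letters would all equal \<open>w ! 0\<close>, more copies than the bound
      \<open>w ! 0 - 1\<close> allows.\<close>
    have w_0: "l < w ! 0"
    proof (rule ccontr)
      assume "\<not> l < w ! 0"
      then show False using code_word_spread[OF 1(2), of 0 "l - 1"] w_pred by simp
    qed
    let ?r = "take l w"
    have len: "length ?r = l" using \<open>l \<le> length w\<close> by simp
    have "?r \<noteq> []" using \<open>0 < l\<close> False by simp
    have row: "nonspecial_row ?r"
      unfolding nonspecial_row_def
    proof (intro conjI)
      show "?r \<noteq> []" by fact
      show "sorted_wrt (\<ge>) ?r" using 1(2) by (simp add: code_word_def sorted_wrt_take)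
      show "length ?r \<le> last ?r"
        using \<open>?r \<noteq> []\<close> w_pred \<open>0 < l\<close> unfolding last_conv_nth[OF \<open>?r \<noteq> []\<close>] len by simp
      show "length ?r < hd ?r"
        using \<open>?r \<noteq> []\<close> w_0 \<open>0 < l\<close> unfolding hd_conv_nth[OF \<open>?r \<noteq> []\<close>] len by simp
    qed
    obtain D where D: "nonspecial_dpp D" "concat D = drop l w"
      using 1(1)[rule_format, OF _ code_word_drop[OF 1(2), of l]] \<open>0 < l\<close> False by auto
    have "fits_below ?r (hd D)" if nonempty: "D \<noteq> []"
    proof -
      obtain s E where DE: "D = s # E" using nonempty by (cases D) auto
      have "s \<noteq> []" using D(1) DE by (simp add: nonspecial_dpp_Cons nonspecial_row_def)
      have "s @ concat E = drop l w" using D(2) DE by simp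
      then have s_len: "length s \<le> length w - l" and
        s_nth: "\<And>t. t < length s \<Longrightarrow> s ! t = w ! (l + t)"
        by (metis length_append length_drop le_add1,
            metis \<open>l \<le> length w\<close> nth_append nth_drop)
      have "0 < length s" using \<open>s \<noteq> []\<close> by simp
      then have "hd s \<le> l"
        using s_nth[of 0] s_len l \<open>s \<noteq> []\<close>
        by (auto simp: hd_conv_nth simp flip: length_greater_0_conv)
      \<comment> \<open>A violation would make positions \<open>Suc t\<close> to
        \<open>l + t\<close> a constant run of \<open>l\<close> letters, whose value is at most
        \<open>l\<close> because it reaches into the tail. At most \<open>l - 1\<close> such copies
        are allowed.\<close>
      moreover have "s ! t < ?r ! Suc t" if "t < length s" "Suc t < l" for t
      proof (rule ccontr)
        assume "\<not> s ! t < ?r ! Suc t"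
        then have ge: "w ! Suc t \<le> w ! (l + t)" using s_nth that by simp
        have "l + t < length w" using that s_len by simp
        with ge have "l + t - Suc t < w ! Suc t - 1"
          using that by (intro code_word_spread[OF 1(2)]) auto
        moreover have "w ! (l + t) \<le> l"
          using antimono[of l "l + t"] l \<open>l + t < length w\<close> by simp
        ultimately show False using ge by simp
      qed
      ultimately show ?thesis using DE len by (simp add: fits_below_def)
    qed
    then have "nonspecial_dpp (?r # D)" using row D by (simp add: nonspecial_dpp_Cons)
    moreover have "concat (?r # D) = w" using D by simp
    ultimately show ?thesis by blast
  qed
qed

section \<open>Multiplicity vectors\<close>

text \<open>Index \<open>j\<close> counts from 0 and stands for the value \<open>Suc j\<close>,
  whose multiplicity is at most \<open>j\<close>. The extensional product fixes the codes outside
  \<open>{..<n}\<close>, so that they can be counted and compared as functions.\<close>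

definition lehmer_codes :: "nat \<Rightarrow> (nat \<Rightarrow> nat) set" where
  "lehmer_codes n = (\<Pi>\<^sub>E j\<in>{..<n}. {..j})"

lemma finite_lehmer_codes: "finite (lehmer_codes n)"
  unfolding lehmer_codes_def by (intro finite_PiE) auto

lemma card_lehmer_codes: "card (lehmer_codes n) = fact n"
  by (simp add: lehmer_codes_def card_PiE fact_prod_Suc atLeast0LessThan)

definition multiplicities :: "nat \<Rightarrow> nat list \<Rightarrow> nat \<Rightarrow> nat" where
  "multiplicities n w = (\<lambda>j\<in>{..<n}. count_list w (Suc j))"

text \<open>Truncated subtraction turns the bound \<open>v - 1\<close> into 0 at
  \<open>v = 0\<close>.\<close>

lemma code_word_positive:
  assumes "code_word w"
  shows "0 \<notin> set w"
  using assms by (metis code_word_def count_list_0_iff diff_0_eq_0 le_zero_eq)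

text \<open>A sorted word is determined by its multiset of letters, and any prescribed
  multiplicities are realised by sorting. Words are reversed because the library sorts in ascending
  order.\<close>

lemma bij_betw_multiplicities:
  "bij_betw (multiplicities n) {w. code_word w \<and> (\<forall>v\<in>set w. v \<le> n)} (lehmer_codes n)"
  unfolding bij_betw_def
proof
  let ?W = "{w. code_word w \<and> (\<forall>v\<in>set w. v \<le> n)}"
  show "inj_on (multiplicities n) ?W"
  proof (rule inj_onI)
    fix u w assume u: "u \<in> ?W" and w: "w \<in> ?W" and eq: "multiplicities n u = multiplicities n w"
    have "count_list u v = count_list w v" for v
    proof (cases "v \<in> {1..n}")
      case True
      then obtain j where "v = Suc j" "j < n" by (cases v) auto
      then show ?thesis using fun_cong[OF eq, of j] by (simp add: multiplicities_def)
    next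
      case False
      then have "v \<notin> set u" "v \<notin> set w"
        using u w code_word_positive[of u] code_word_positive[of w] not_less_eq_eq by fastforce+
      then show ?thesis by (metis count_list_0_iff)
    qed
    then have "mset (rev u) = mset (rev w)"
      by (intro multiset_eqI) (simp flip: count_mset)
    moreover have "sorted (rev u)" "sorted (rev w)"
      using u w by (simp_all add: code_word_def sorted_wrt_rev)
    ultimately have "rev u = rev w" by (metis properties_for_sort)
    then show "u = w" by simp
  qed
  show "multiplicities n ` ?W = lehmer_codes n"
  proof
    show "multiplicities n ` ?W \<subseteq> lehmer_codes n"
    proof clarify
      fix w assume "code_word w"
      then have "count_list w (Suc j) \<le> j" for j by (metis code_word_def diff_Suc_1)
      then show "multiplicities n w \<in> lehmer_codes n"
        by (simp add: multiplicities_def lehmer_codes_def)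
    qed
    show "lehmer_codes n \<subseteq> multiplicities n ` ?W"
    proof
      fix m assume m: "m \<in> lehmer_codes n"
      define M where "M = (\<Sum>j<n. replicate_mset (m j) (Suc j))"
      define w where "w = rev (sorted_list_of_multiset M)"
      have count_M: "count M v = (if v \<in> {1..n} then m (v - 1) else 0)" for v
      proof -
        have "count M v = (\<Sum>j<n. if Suc j = v then m j else 0)"
          by (auto simp: M_def count_sum intro: sum.cong)
        also have "\<dots> = (\<Sum>j<n. if j = v - 1 then (if v = 0 then 0 else m j) else 0)"
          by (intro sum.cong) auto
        also have "\<dots> = (if v \<in> {1..n} then m (v - 1) else 0)"
          by (subst sum.delta) auto
        finally show ?thesis .
      qed
      have count_w: "count_list w v = count M v" for v
        by (simp add: w_def flip: count_mset)
      have "count_list w v \<le> v - 1" for v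
        using m by (auto simp: count_w count_M lehmer_codes_def PiE_def Pi_def)
      moreover have "sorted_wrt (\<ge>) w"
        unfolding w_def by (simp add: sorted_wrt_rev)
      moreover have "v \<le> n" if "v \<in> set w" for v
        using that count_list_0_iff[of w v] by (auto simp: count_w count_M split: if_splits)
      ultimately have "w \<in> ?W" by (simp add: code_word_def)
      moreover have "multiplicities n w = m"
        using m by (auto simp: multiplicities_def count_w count_M lehmer_codes_def PiE_def
            extensional_def fun_eq_iff)
      ultimately show "m \<in> multiplicities n ` ?W" by blast
    qed
  qed
qed

lemma sum_multiplicities:
  assumes "code_word w" "\<forall>v\<in>set w. v \<le> n"
  shows "(\<Sum>j<n. multiplicities n w j) = length w"
proof -
  have "(\<Sum>j<n. multiplicities n w j) = (\<Sum>v\<in>Suc ` {..<n}. count_list w v)"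
    by (simp add: multiplicities_def sum.reindex)
  also have "\<dots> = length w"
  proof (rule sum_count_set)
    show "set w \<subseteq> Suc ` {..<n}"
    proof
      fix v assume v: "v \<in> set w"
      then have "v \<noteq> 0" using code_word_positive[OF assms(1)] by metis
      then show "v \<in> Suc ` {..<n}" using assms(2) v
        by (intro image_eqI[of _ _ "v - 1"]) auto
    qed
  qed simp
  finally show ?thesis .
qed

lemma bij_betw_concat_nonspecial_dpp:
  "bij_betw concat {D. nonspecial_dpp D \<and> (\<forall>v\<in>set (concat D). v \<le> n)}
     {w. code_word w \<and> (\<forall>v\<in>set w. v \<le> n)}"
  unfolding bij_betw_def
proof
  show "inj_on concat {D. nonspecial_dpp D \<and> (\<forall>v\<in>set (concat D). v \<le> n)}"
    by (rule inj_onI) (simp add: nonspecial_dpp_concat_inj)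
next
  show "concat ` {D. nonspecial_dpp D \<and> (\<forall>v\<in>set (concat D). v \<le> n)} =
      {w. code_word w \<and> (\<forall>v\<in>set w. v \<le> n)}" (is "_ ` ?A = ?B")
  proof
    show "concat ` ?A \<subseteq> ?B" using nonspecial_dpp_imp_code_word by force
    show "?B \<subseteq> concat ` ?A"
    proof
      fix w assume w: "w \<in> ?B"
      then obtain D where "nonspecial_dpp D" "concat D = w"
        using code_word_imp_nonspecial_dpp by blast
      with w show "w \<in> concat ` ?A" by blast
    qed
  qed
qed

section \<open>Lehmer codes of permutation matrices\<close>

definition lehmer :: "nat \<Rightarrow> (nat \<Rightarrow> nat) \<Rightarrow> nat \<Rightarrow> nat" where
  "lehmer n \<sigma> = (\<lambda>j\<in>{..<n}. card {i. i < j \<and> \<sigma> j < \<sigma> i})"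

lemma lehmer_in_lehmer_codes: "lehmer n \<sigma> \<in> lehmer_codes n"
proof -
  have "card {i. i < j \<and> \<sigma> j < \<sigma> i} \<le> j" for j
    using card_mono[of "{..<j}" "{i. i < j \<and> \<sigma> j < \<sigma> i}"] by auto
  then show ?thesis by (auto simp: lehmer_def lehmer_codes_def)
qed

text \<open>In this form the code at \<open>j\<close> depends only on the value at \<open>j\<close>
  and on the set of values at positions up to \<open>j\<close>, which is what decoding from the
  right needs.\<close>

lemma lehmer_conv_card_image:
  assumes "\<sigma> permutes {..<n}" "j < n"
  shows "lehmer n \<sigma> j = card {y \<in> \<sigma> ` {..j}. \<sigma> j < y}"
proof -
  have "{y \<in> \<sigma> ` {..j}. \<sigma> j < y} = \<sigma> ` {i. i < j \<and> \<sigma> j < \<sigma> i}"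
    by (auto simp: image_iff) (metis less_irrefl order_le_less)
  moreover have "inj_on \<sigma> {i. i < j \<and> \<sigma> j < \<sigma> i}"
    using permutes_inj[OF assms(1)] by (rule inj_on_subset) simp
  ultimately show ?thesis using assms(2) by (simp add: card_image lehmer_def)
qed

lemma card_greater_inj:
  fixes x y :: "'a::linorder"
  assumes "finite S" "x \<in> S" "y \<in> S" "card {z \<in> S. x < z} = card {z \<in> S. y < z}"
  shows "x = y"
proof -
  have "card {z \<in> S. b < z} < card {z \<in> S. a < z}" if "a < b" "b \<in> S" for a b
    using that assms(1) by (intro psubset_card_mono) auto
  from this[of x y] this[of y x] show ?thesis
    using assms(2-4) by (cases x y rule: linorder_cases) auto
qed

text \<open>A permutation is recovered from its code from right to left: once the values at the
  positions \<open>> j\<close> are known, so is the set of the remaining values, and the code at \<open>j\<close>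
  is the rank of the value at \<open>j\<close> in this set.\<close>

lemma inj_on_lehmer: "inj_on (lehmer n) {\<sigma>. \<sigma> permutes {..<n}}"
proof (rule inj_onI)
  fix \<sigma> \<tau> assume perm: "\<sigma> \<in> {\<sigma>. \<sigma> permutes {..<n}}" "\<tau> \<in> {\<sigma>. \<sigma> permutes {..<n}}"
    and eq: "lehmer n \<sigma> = lehmer n \<tau>"
  have image: "\<rho> ` {..j} = {..<n} - \<rho> ` {j<..<n}" if "\<rho> permutes {..<n}" "j < n" for \<rho> j
  proof -
    have "{..j} = {..<n} - {j<..<n}" using that(2) by auto
    then show ?thesis
      using that(1) by (simp add: image_set_diff permutes_inj permutes_image)
  qed
  have "\<sigma> j = \<tau> j" if "j < n" for j
    using that
  proof (induction "n - j" arbitrary: j rule: less_induct)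
    case less
    have "\<sigma> i = \<tau> i" if "i \<in> {j<..<n}" for i
      using that by (intro less) auto
    then have "\<sigma> ` {j<..<n} = \<tau> ` {j<..<n}" by (intro image_cong) auto
    then have same: "\<sigma> ` {..j} = \<tau> ` {..j}" using image perm less.prems by simp
    show ?case
    proof (rule card_greater_inj)
      show "finite (\<sigma> ` {..j})" "\<sigma> j \<in> \<sigma> ` {..j}" by auto
      show "\<tau> j \<in> \<sigma> ` {..j}" unfolding same by simp
      show "card {y \<in> \<sigma> ` {..j}. \<sigma> j < y} = card {y \<in> \<sigma> ` {..j}. \<tau> j < y}"
        using lehmer_conv_card_image[of \<sigma> n j] lehmer_conv_card_image[of \<tau> n j]
          perm less.prems eq same by simp
    qed
  qed
  moreover have "\<sigma> j = \<tau> j" if "\<not> j < n" for j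
    using that perm by (simp add: permutes_def)
  ultimately show "\<sigma> = \<tau>" by blast
qed

text \<open>Surjectivity comes from counting: the map is injective and both sides have
  \<open>fact n\<close> elements.\<close>

lemma bij_betw_lehmer: "bij_betw (lehmer n) {\<sigma>. \<sigma> permutes {..<n}} (lehmer_codes n)"
proof -
  have "card (lehmer n ` {\<sigma>. \<sigma> permutes {..<n}}) = card (lehmer_codes n)"
    by (simp add: card_image[OF inj_on_lehmer] card_permutations[OF card_lessThan] card_lehmer_codes)
  then have "lehmer n ` {\<sigma>. \<sigma> permutes {..<n}} = lehmer_codes n"
    using lehmer_in_lehmer_codes by (intro card_subset_eq finite_lehmer_codes) auto
  then show ?thesis using inj_on_lehmer by (simp add: bij_betw_def)
qed

text \<open>Every other value stands to the left of the last position, so the last code entry counts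
  all values in \<open>{..<n}\<close> above \<open>\<sigma> (n - 1)\<close>.\<close>

lemma lehmer_last:
  assumes "\<sigma> permutes {..<n}" "0 < n"
  shows "lehmer n \<sigma> (n - 1) + Suc (\<sigma> (n - 1)) = n"
proof -
  have "{..n - 1} = {..<n}" using assms(2) by auto
  then have "lehmer n \<sigma> (n - 1) = card {y \<in> {..<n}. \<sigma> (n - 1) < y}"
    using lehmer_conv_card_image[OF assms(1), of "n - 1"] assms by (simp add: permutes_image)
  also have "{y \<in> {..<n}. \<sigma> (n - 1) < y} = {\<sigma> (n - 1)<..<n}" by auto
  finally show ?thesis
    using assms permutes_in_image[OF assms(1), of "n - 1"] by simp
qed

section \<open>Permutation matrices and their inversions\<close>

definition perm_mat :: "nat \<Rightarrow> (nat \<Rightarrow> nat) \<Rightarrow> int mat" where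
  "perm_mat n \<sigma> = mat n n (\<lambda>(i, j). of_bool (i = \<sigma> j))"

lemma permutation_matrix_perm_mat:
  assumes "\<sigma> permutes {..<n}"
  shows "permutation_matrix n (perm_mat n \<sigma>)"
proof -
  have less: "\<sigma> j < n \<longleftrightarrow> j < n" for j using permutes_in_image[OF assms, of j] by simp
  have "\<exists>!j. j < n \<and> i = \<sigma> j" if "i < n" for i
    using that permutes_inverses[OF assms] less by metis
  moreover have "\<exists>!i. i < n \<and> i = \<sigma> j" if "j < n" for j
    using that less by blast
  ultimately show ?thesis
    by (auto simp: permutation_matrix_def perm_mat_def cong: conj_cong)
qed

lemma bij_betw_perm_mat:
  "bij_betw (perm_mat n) {\<sigma>. \<sigma> permutes {..<n}} {A. permutation_matrix n A}"
  unfolding bij_betw_def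
proof
  show "inj_on (perm_mat n) {\<sigma>. \<sigma> permutes {..<n}}"
  proof (rule inj_onI)
    fix \<sigma> \<tau> assume perm: "\<sigma> \<in> {\<sigma>. \<sigma> permutes {..<n}}" "\<tau> \<in> {\<sigma>. \<sigma> permutes {..<n}}"
      and eq: "perm_mat n \<sigma> = perm_mat n \<tau>"
    show "\<sigma> = \<tau>"
    proof
      fix j show "\<sigma> j = \<tau> j"
      proof (cases "j < n")
        case True
        then have "\<sigma> j < n" using perm permutes_in_image[of \<sigma> "{..<n}" j] by simp
        then have "perm_mat n \<sigma> $$ (\<sigma> j, j) = 1" "perm_mat n \<tau> $$ (\<sigma> j, j) = of_bool (\<sigma> j = \<tau> j)"
          using True by (simp_all add: perm_mat_def)
        then show ?thesis using eq by (simp split: if_splits)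
      next
        case False
        then show ?thesis using perm by (simp add: permutes_def)
      qed
    qed
  qed
  show "perm_mat n ` {\<sigma>. \<sigma> permutes {..<n}} = {A. permutation_matrix n A}"
  proof
    show "perm_mat n ` {\<sigma>. \<sigma> permutes {..<n}} \<subseteq> {A. permutation_matrix n A}"
      using permutation_matrix_perm_mat by auto
    show "{A. permutation_matrix n A} \<subseteq> perm_mat n ` {\<sigma>. \<sigma> permutes {..<n}}"
    proof
      fix A assume "A \<in> {A. permutation_matrix n A}"
      then have carrier: "A \<in> carrier_mat n n"
        and entries: "\<And>i j. i < n \<Longrightarrow> j < n \<Longrightarrow> A $$ (i, j) \<in> {0, 1}"
        and rows: "\<And>i. i < n \<Longrightarrow> \<exists>!j. j < n \<and> A $$ (i, j) = 1"
        and cols: "\<And>j. j < n \<Longrightarrow> \<exists>!i. i < n \<and> A $$ (i, j) = 1"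
        by (auto simp: permutation_matrix_def)
      \<comment> \<open>\<open>\<sigma>\<close> sends a column to the row of its 1. The identity
        outside \<open>{..<n}\<close> is what \<open>permutes\<close> demands.\<close>
      define \<sigma> where "\<sigma> j = (if j < n then THE i. i < n \<and> A $$ (i, j) = 1 else j)" for j
      have \<sigma>: "\<sigma> j < n" "A $$ (\<sigma> j, j) = 1" if "j < n" for j
        using theI'[OF cols[OF that]] that by (simp_all add: \<sigma>_def)
      \<comment> \<open>Two columns with the same image would put two 1's into one row.\<close>
      have inj: "inj_on \<sigma> {..<n}"
        by (rule inj_onI) (metis \<sigma> rows lessThan_iff)
      then have "\<sigma> ` {..<n} = {..<n}"
        using \<sigma> by (intro endo_inj_surj) auto
      then have "\<sigma> permutes {..<n}"
        using inj by (intro bij_imp_permutes) (auto simp: bij_betw_def \<sigma>_def)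
      moreover have "A = perm_mat n \<sigma>"
      proof (rule eq_matI)
        fix i j assume "i < dim_row (perm_mat n \<sigma>)" "j < dim_col (perm_mat n \<sigma>)"
        then have ij: "i < n" "j < n" by (simp_all add: perm_mat_def)
        have "A $$ (i, j) = of_bool (i = \<sigma> j)"
          using entries[OF ij] \<sigma>[OF ij(2)] cols[OF ij(2)] ij by auto
        then show "A $$ (i, j) = perm_mat n \<sigma> $$ (i, j)" using ij by (simp add: perm_mat_def)
      qed (use carrier in \<open>auto simp: perm_mat_def\<close>)
      ultimately show "A \<in> perm_mat n ` {\<sigma>. \<sigma> permutes {..<n}}" by blast
    qed
  qed
qed

text \<open>A contributing pair consists of the 1's in columns \<open>j < l\<close> with
  \<open>\<sigma> l < \<sigma> j\<close>. Collecting the pairs by their right column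
  \<open>l\<close> gives the code entry at \<open>l\<close>.\<close>

lemma inversion_number_perm_mat:
  assumes "\<sigma> permutes {..<n}"
  shows "inversion_number (perm_mat n \<sigma>) = int (\<Sum>j<n. lehmer n \<sigma> j)"
proof -
  have less: "\<sigma> j < n" if "j < n" for j using permutes_in_image[OF assms, of j] that by simp
  have "inversion_number (perm_mat n \<sigma>) = (\<Sum>i<n. \<Sum>j<n. \<Sum>k<i. \<Sum>l\<in>{j<..<n}.
      of_bool (i = \<sigma> j) * of_bool (k = \<sigma> l))"
    unfolding inversion_number_def
    by (intro sum.cong refl) (auto simp: perm_mat_def)
  also have "\<dots> = (\<Sum>j<n. \<Sum>i<n. if i = \<sigma> j then \<Sum>k<i. \<Sum>l\<in>{j<..<n}. of_bool (k = \<sigma> l) else 0)"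
    by (subst sum.swap) (intro sum.cong refl, auto)
  also have "\<dots> = (\<Sum>j<n. \<Sum>k<\<sigma> j. \<Sum>l\<in>{j<..<n}. of_bool (k = \<sigma> l))"
  proof (rule sum.cong[OF refl])
    fix j assume "j \<in> {..<n}"
    then have "\<sigma> j \<in> {..<n}" using less by simp
    then show "(\<Sum>i<n. if i = \<sigma> j then \<Sum>k<i. \<Sum>l\<in>{j<..<n}. of_bool (k = \<sigma> l) else 0) =
        (\<Sum>k<\<sigma> j. \<Sum>l\<in>{j<..<n}. of_bool (k = \<sigma> l) :: int)"
      by simp
  qed
  \<comment> \<open>For fixed \<open>l\<close> only the row \<open>k = \<sigma> l\<close>
    contributes, and it is in range exactly when \<open>\<sigma> l < \<sigma> j\<close>.\<close>
  also have "\<dots> = (\<Sum>j<n. \<Sum>l\<in>{j<..<n}. of_bool (\<sigma> l < \<sigma> j))"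
    by (subst sum.swap) (auto simp: of_bool_def intro!: sum.cong)
  also have "\<dots> = (\<Sum>j<n. \<Sum>l<n. of_bool (j < l \<and> \<sigma> l < \<sigma> j))"
    by (intro sum.cong refl sum.mono_neutral_cong_left) auto
  also have "\<dots> = (\<Sum>l<n. \<Sum>j<n. of_bool (j < l \<and> \<sigma> l < \<sigma> j))"
    by (rule sum.swap)
  also have "\<dots> = (\<Sum>l<n. int (lehmer n \<sigma> l))"
  proof (intro sum.cong refl)
    fix l assume "l \<in> {..<n}"
    then have "{..<n} \<inter> {j. j < l \<and> \<sigma> l < \<sigma> j} = {j. j < l \<and> \<sigma> l < \<sigma> j}" by auto
    then show "(\<Sum>j<n. of_bool (j < l \<and> \<sigma> l < \<sigma> j)) = int (lehmer n \<sigma> l)"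
      using \<open>l \<in> {..<n}\<close> by (simp add: lehmer_def sum_of_bool_eq)
  qed
  finally show ?thesis by simp
qed

section \<open>Matching the statistics and composing the bijections\<close>

theorem theorem2p4:
  fixes n p k :: nat
  assumes "0 < n"
  shows "\<exists>f. bij_betw f
           {D. dpp_of_order n D \<and> special_parts D = {} \<and> num_parts D = p \<and> num_parts_eq n D = k}
           {A. permutation_matrix n A \<and> inversion_number A = int p \<and>
               (\<exists>r<n. A $$ (r, n - 1) = 1 \<and> int (r + 1) = int n - int k)}"
proof -
  let ?dpps = "{D. nonspecial_dpp D \<and> (\<forall>v\<in>set (concat D). v \<le> n)}"
  let ?perms = "{\<sigma>. \<sigma> permutes {..<n}}"
  let ?codes = "{m \<in> lehmer_codes n. (\<Sum>j<n. m j) = p \<and> m (n - 1) = k}"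
  have "bij_betw (multiplicities n \<circ> concat) ?dpps (lehmer_codes n)"
    by (rule bij_betw_trans[OF bij_betw_concat_nonspecial_dpp bij_betw_multiplicities])
  \<comment> \<open>The bijection restricts because the entries of the code sum to the number of
    parts and its last entry is the multiplicity of the value \<open>n\<close>.\<close>
  then have dpps: "bij_betw (multiplicities n \<circ> concat)
      {D \<in> ?dpps. num_parts D = p \<and> num_parts_eq n D = k} ?codes"
  proof (rule bij_betw_Collect)
    fix D assume "D \<in> ?dpps"
    then have "(\<Sum>j<n. multiplicities n (concat D) j) = num_parts D"
      unfolding num_parts_eq_length
      using nonspecial_dpp_imp_code_word by (intro sum_multiplicities) auto
    moreover have "multiplicities n (concat D) (n - 1) = num_parts_eq n D"
      using assms by (simp add: multiplicities_def num_parts_eq_count_list)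
    ultimately show "((\<Sum>j<n. (multiplicities n \<circ> concat) D j) = p \<and>
        (multiplicities n \<circ> concat) D (n - 1) = k) \<longleftrightarrow> num_parts D = p \<and> num_parts_eq n D = k"
      by simp
  qed
  have dpps_eq: "{D \<in> ?dpps. num_parts D = p \<and> num_parts_eq n D = k} =
      {D. dpp_of_order n D \<and> special_parts D = {} \<and> num_parts D = p \<and> num_parts_eq n D = k}"
    using dpp_of_order_iff[of n] by blast
  have perms: "bij_betw (lehmer n)
      {\<sigma> \<in> ?perms. (\<Sum>j<n. lehmer n \<sigma> j) = p \<and> lehmer n \<sigma> (n - 1) = k} ?codes"
    using bij_betw_lehmer by (rule bij_betw_Collect) simp
  have mats: "bij_betw (perm_mat n)
      {\<sigma> \<in> ?perms. (\<Sum>j<n. lehmer n \<sigma> j) = p \<and> lehmer n \<sigma> (n - 1) = k}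
      {A \<in> {A. permutation_matrix n A}. inversion_number A = int p \<and>
        (\<exists>r<n. A $$ (r, n - 1) = 1 \<and> int (r + 1) = int n - int k)}"
      (is "bij_betw _ ?perms' ?mats'")
    using bij_betw_perm_mat
  proof (rule bij_betw_Collect)
    fix \<sigma> assume "\<sigma> \<in> ?perms"
    then have \<sigma>: "\<sigma> permutes {..<n}" by simp
    have "\<sigma> (n - 1) < n" using permutes_in_image[OF \<sigma>, of "n - 1"] assms by simp
    then have "(\<exists>r<n. perm_mat n \<sigma> $$ (r, n - 1) = 1 \<and> int (r + 1) = int n - int k) \<longleftrightarrow>
        int (\<sigma> (n - 1) + 1) = int n - int k"
      using assms by (auto simp: perm_mat_def)
    \<comment> \<open>The last code entry and the row number counted from 1 add up to
      \<open>n\<close>; working in the integers avoids truncation when \<open>k\<close> exceeds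
      \<open>n\<close>.\<close>
    also have "\<dots> \<longleftrightarrow> lehmer n \<sigma> (n - 1) = k"
      using lehmer_last[OF \<sigma> assms] by linarith
    finally show "(inversion_number (perm_mat n \<sigma>) = int p \<and>
        (\<exists>r<n. perm_mat n \<sigma> $$ (r, n - 1) = 1 \<and> int (r + 1) = int n - int k)) \<longleftrightarrow>
        (\<Sum>j<n. lehmer n \<sigma> j) = p \<and> lehmer n \<sigma> (n - 1) = k"
      unfolding inversion_number_perm_mat[OF \<sigma>] by (simp only: of_nat_eq_iff)
  qed
  \<comment> \<open>Both sides are linked through the same set of codes: array to word to code, back
    to a permutation, then to its matrix.\<close>
  have "bij_betw (perm_mat n \<circ> (inv_into ?perms' (lehmer n) \<circ> (multiplicities n \<circ> concat)))
      {D \<in> ?dpps. num_parts D = p \<and> num_parts_eq n D = k} ?mats'"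
    by (rule bij_betw_trans[OF bij_betw_trans[OF dpps bij_betw_inv_into[OF perms]] mats])
  then show ?thesis
    unfolding dpps_eq unfolding mem_Collect_eq by blast
qed

end
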